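(* Let $m\ge 2$ and $k\in\mathbb{N}$, and let $n\ge 0$ satisfy $n\equiv i\pmod m$ with $i\in\{0,\ldots,m-1\}$. Then \[ a_m(k,n)\le\left(\frac{m}{m-1}\right)^{\lfloor (k-i)/m\rfloor}\prod_{j=0}^{\lfloor (k-i)/m\rfloor-1}(k-i-jm). \] In particular, for each fixed $k$ the sequence $(a_m(k,n))_{n=0}^{\infty}$ is bounded.
   Context: For integers $m\ge 2$, $k\ge 0$, $n\ge 0$, $a_m(k,n)$ denotes the number of partitions of $n$ into exactly $k$ parts, each part being a power of $m$ (i.e. $a_m(k,n)$ is the coefficient of $t^k$ in $p_m(n,t)$, where $\prod_{j\ge0}\frac{1}{1-tq^{m^j}}=\sum_n p_m(n,t)q^n$). An empty product equals $1$. *)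

theory Defs
  imports Complex_Main "HOL-Library.Multiset" "HOL-Number_Theory.Cong"
begin

definition mary_partitions :: "nat \<Rightarrow> nat \<Rightarrow> nat \<Rightarrow> nat multiset set" where
  "mary_partitions m k n =
     {P. size P = k \<and> sum_mset P = n \<and> (\<forall>x\<in>#P. \<exists>j. x = m ^ j)}"

definition mary_count :: "nat \<Rightarrow> nat \<Rightarrow> nat \<Rightarrow> nat" where
  "mary_count m k n = card (mary_partitions m k n)"

lemma finite_mary_partitions: "finite (mary_partitions m k n)"
proof (rule finite_subset)
  show "mary_partitions m k n \<subseteq> mset ` {xs. set xs \<subseteq> {..n} \<and> length xs = k}"
  proof
    fix P assume P: "P \<in> mary_partitions m k n"
    obtain xs where xs: "mset xs = P" using ex_mset by blast
    have "x \<le> n" if "x \<in># P" for x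
      using P multi_member_split[OF that] by (auto simp: mary_partitions_def)
    moreover have "length xs = k"
      using P xs by (auto simp: mary_partitions_def)
    ultimately show "P \<in> mset ` {xs. set xs \<subseteq> {..n} \<and> length xs = k}"
      using xs by auto
  qed
  show "finite (mset ` {xs. set xs \<subseteq> {..n} \<and> length xs = k})"
    by (intro finite_imageI finite_lists_length_eq) simp
qed

end

theory Submission
  imports Defs
begin

text \<open>
  Write \<open>a(k,n)\<close> for the number of partitions.  Removing a part \<open>1\<close>, or dividing all parts by \<open>m\<close>
  when there is none, gives a recursion that shows \<open>a(k, mN + i) = a(k - i, mN)\<close> for \<open>i < m\<close> and
  \<open>a(k, m(N + 1)) = a(k, N + 1) + a(k - m, mN)\<close>.  If \<open>n = m\<^sup>s M\<close> with \<open>m\<close> not dividing \<open>M\<close>,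
  iteration yields \<open>a(k,n) = a(k,M) + \<Sum>\<^sub>t a(k - m, m(m\<^sup>t M - 1))\<close> with \<open>t < s\<close>.  The lowest \<open>t\<close>
  base-\<open>m\<close> digits of \<open>m\<^sup>t M - 1\<close> all equal \<open>m - 1\<close>, so only the terms with \<open>t(m - 1) \<le> k - m\<close>
  survive.  Hence \<open>a(k,n) \<le> B(k)\<close>, where \<open>B\<close> is the monotone sequence with \<open>B(k) = 1\<close> for \<open>k < m\<close>
  and \<open>B(k) = B(k - 1) + (1 + \<lfloor>(k - m)/(m - 1)\<rfloor>) B(k - m)\<close> otherwise.  Adding up \<open>m\<close> consecutive
  increments gives \<open>(m - 1) B(k) \<le> m k B(k - m)\<close>, which unrolls to the claimed product.
\<close>

lemma mary_partitions_with_one: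
  "{P \<in> mary_partitions m (Suc k) (Suc n). 1 \<in># P} = add_mset 1 ` mary_partitions m k n"
proof (intro equalityI subsetI)
  fix P assume P: "P \<in> {P \<in> mary_partitions m (Suc k) (Suc n). 1 \<in># P}"
  then obtain Q where "P = add_mset 1 Q" by (auto dest: multi_member_split)
  with P show "P \<in> add_mset 1 ` mary_partitions m k n"
    by (auto simp: mary_partitions_def)
next
  fix P assume "P \<in> add_mset 1 ` mary_partitions m k n"
  moreover have "\<exists>j. Suc 0 = m ^ j" by (rule exI[of _ 0]) simp
  ultimately show "P \<in> {P \<in> mary_partitions m (Suc k) (Suc n). 1 \<in># P}"
    by (auto simp: mary_partitions_def)
qed

lemma mary_count_0_left: "mary_count m 0 n = (if n = 0 then 1 else 0)"
proof -
  have "mary_partitions m 0 n = (if n = 0 then {{#}} else {})"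
    by (auto simp: mary_partitions_def)
  then show ?thesis by (simp add: mary_count_def)
qed

context
  fixes m :: nat
  assumes base_ge_2: "m \<ge> 2"
begin

lemma image_mset_mult_in_mary_partitions:
  assumes "Q \<in> mary_partitions m k n"
  shows "image_mset ((*) m) Q \<in> {P \<in> mary_partitions m k (m * n). 1 \<notin># P}"
proof -
  have "\<exists>j. m * y = m ^ j" if "y \<in># Q" for y
  proof -
    obtain j where "y = m ^ j" using assms \<open>y \<in># Q\<close> by (auto simp: mary_partitions_def)
    then have "m * y = m ^ Suc j" by simp
    then show ?thesis ..
  qed
  then show ?thesis
    using assms base_ge_2 sum_mset_distrib_left[of m "\<lambda>x. x" Q]
    by (auto simp: mary_partitions_def)
qed

lemma mary_partition_without_oneE:
  assumes P: "P \<in> mary_partitions m k n" and "1 \<notin># P"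
  obtains Q N where "n = m * N" "Q \<in> mary_partitions m k N" "P = image_mset ((*) m) Q"
proof -
  have parts: "\<exists>j. x = m * m ^ j" if "x \<in># P" for x
  proof -
    obtain j where "x = m ^ j" using P \<open>x \<in># P\<close> by (auto simp: mary_partitions_def)
    with \<open>x \<in># P\<close> \<open>1 \<notin># P\<close> show ?thesis by (cases j) auto
  qed
  define Q where "Q = image_mset (\<lambda>x. x div m) P"
  have "image_mset ((*) m) Q = image_mset (\<lambda>x. x) P"
    unfolding Q_def multiset.map_comp o_def using parts by (intro image_mset_cong) fastforce
  then have P_eq: "P = image_mset ((*) m) Q" by simp
  have "\<exists>j. y = m ^ j" if "y \<in># Q" for y
    using that parts base_ge_2 by (fastforce simp: Q_def)
  then have "Q \<in> mary_partitions m k (sum_mset Q)"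
    using P by (simp add: mary_partitions_def P_eq)
  moreover have "n = m * sum_mset Q"
    using P sum_mset_distrib_left[of m "\<lambda>x. x" Q] by (simp add: mary_partitions_def P_eq)
  ultimately show ?thesis using that P_eq by blast
qed

lemma mary_partitions_without_one:
  "{P \<in> mary_partitions m k n. 1 \<notin># P} =
    (if m dvd n then image_mset ((*) m) ` mary_partitions m k (n div m) else {})"
proof (intro equalityI subsetI)
  fix P assume "P \<in> {P \<in> mary_partitions m k n. 1 \<notin># P}"
  then obtain Q N where "n = m * N" "Q \<in> mary_partitions m k N" "P = image_mset ((*) m) Q"
    using mary_partition_without_oneE[of P k n] by blast
  then show "P \<in> (if m dvd n then image_mset ((*) m) ` mary_partitions m k (n div m) else {})"
    using base_ge_2 by simp
next
  fix P
  assume "P \<in> (if m dvd n then image_mset ((*) m) ` mary_partitions m k (n div m) else {})"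
  then show "P \<in> {P \<in> mary_partitions m k n. 1 \<notin># P}"
    using image_mset_mult_in_mary_partitions[of _ k "n div m"] by (auto split: if_splits)
qed

lemma mary_count_Suc_Suc:
  "mary_count m (Suc k) (Suc n) =
    mary_count m k n + (if m dvd Suc n then mary_count m (Suc k) (Suc n div m) else 0)"
proof -
  let ?A = "mary_partitions m (Suc k) (Suc n)"
  have "inj (image_mset ((*) m))"
    using base_ge_2 by (intro multiset.inj_map) (auto intro!: injI)
  then have "card {P \<in> ?A. 1 \<notin># P} =
      (if m dvd Suc n then mary_count m (Suc k) (Suc n div m) else 0)"
    unfolding mary_partitions_without_one
    by (auto simp: mary_count_def card_image inj_on_subset)
  moreover have "card {P \<in> ?A. 1 \<in># P} = mary_count m k n"
    unfolding mary_partitions_with_one by (simp add: mary_count_def card_image inj_on_def)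
  moreover have "card ?A = card {P \<in> ?A. 1 \<in># P} + card {P \<in> ?A. 1 \<notin># P}"
    by (subst card_Un_disjoint[symmetric])
       (auto simp: finite_mary_partitions intro!: arg_cong[of _ _ card])
  ultimately show ?thesis by (simp add: mary_count_def)
qed

lemma mary_count_0_right: "mary_count m k 0 = (if k = 0 then 1 else 0)"
proof -
  have "P = {#}" if "P \<in> mary_partitions m k 0" for P
  proof (rule ccontr)
    assume "P \<noteq> {#}"
    then obtain x where "x \<in># P" by auto
    with that have "x = 0" "\<exists>j. x = m ^ j" by (auto simp: mary_partitions_def)
    with base_ge_2 show False by auto
  qed
  moreover have "{#} \<in> mary_partitions m k 0 \<longleftrightarrow> k = 0"
    by (auto simp: mary_partitions_def)
  ultimately have "mary_partitions m k 0 = (if k = 0 then {{#}} else {})"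
    by auto
  then show ?thesis by (simp add: mary_count_def)
qed

lemma mary_count_mult_add:
  assumes "i < m"
  shows "mary_count m k (m * N + i) = (if i \<le> k then mary_count m (k - i) (m * N) else 0)"
  using assms
proof (induction i arbitrary: k)
  case (Suc i)
  show ?case
  proof (cases k)
    case 0
    then show ?thesis by (simp add: mary_count_0_left)
  next
    case (Suc l)
    have "\<not> m dvd m * N + Suc i"
      using Suc.prems by (simp add: dvd_add_right_iff nat_dvd_not_less del: add_Suc_right)
    with Suc Suc.IH[of l] Suc.prems show ?thesis by (simp add: mary_count_Suc_Suc)
  qed
qed simp

lemma mary_count_mod:
  "mary_count m k n =
    (if n mod m \<le> k then mary_count m (k - n mod m) (m * (n div m)) else 0)"
  using mary_count_mult_add[of "n mod m" k "n div m"] base_ge_2 by simp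

lemma mary_count_mult_Suc:
  "mary_count m k (m * Suc N) =
    mary_count m k (Suc N) + (if m \<le> k then mary_count m (k - m) (m * N) else 0)"
proof (cases k)
  case 0
  with base_ge_2 show ?thesis by (simp add: mary_count_0_left)
next
  case (Suc l)
  have pred: "m * Suc N = Suc (m * N + (m - 1))" using base_ge_2 by simp
  have "mary_count m k (m * Suc N) = mary_count m l (m * N + (m - 1)) + mary_count m k (Suc N)"
    using mary_count_Suc_Suc[of l "m * N + (m - 1)"] base_ge_2
    unfolding pred[symmetric] Suc by simp
  moreover have "mary_count m l (m * N + (m - 1)) =
      (if m \<le> k then mary_count m (k - m) (m * N) else 0)"
    using mary_count_mult_add[of "m - 1" l N] base_ge_2 Suc by auto
  ultimately show ?thesis by simp
qed

lemma mary_count_power_mult: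
  assumes "M > 0"
  shows "mary_count m k (m ^ s * M) = mary_count m k M +
    (if m \<le> k then \<Sum>t<s. mary_count m (k - m) (m * (m ^ t * M - 1)) else 0)"
proof (induction s)
  case (Suc s)
  have "m ^ s * M > 0" using assms base_ge_2 by simp
  then have "mary_count m k (m * (m ^ s * M)) = mary_count m k (m ^ s * M) +
      (if m \<le> k then mary_count m (k - m) (m * (m ^ s * M - 1)) else 0)"
    using mary_count_mult_Suc[of k "m ^ s * M - 1"] by simp
  with Suc show ?case by (simp add: mult.assoc)
qed simp

lemma mary_count_mult_nonzero:
  assumes "mary_count m k (m * N) \<noteq> 0"
  shows "\<exists>l\<le>k. mary_count m l N \<noteq> 0"
  using assms
proof (induction N arbitrary: k)
  case (Suc N)
  show ?case
  proof (cases "mary_count m k (Suc N) = 0")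
    case True
    with Suc.prems have "m \<le> k" "mary_count m (k - m) (m * N) \<noteq> 0"
      unfolding mary_count_mult_Suc by (auto split: if_splits)
    with Suc.IH obtain l where "l \<le> k - m" "mary_count m l N \<noteq> 0" by blast
    then have "Suc l \<le> k" "mary_count m (Suc l) (Suc N) \<noteq> 0"
      using \<open>m \<le> k\<close> base_ge_2 by (auto simp: mary_count_Suc_Suc)
    then show ?thesis by blast
  qed auto
qed auto

lemma parts_ge_if_power_dvd_Suc:
  assumes "m ^ t dvd Suc n" "mary_count m k n \<noteq> 0"
  shows "t * (m - 1) \<le> k"
  using assms
proof (induction t arbitrary: k n)
  case (Suc t)
  from Suc.prems(1) obtain c where Suc_n: "Suc n = m * (m ^ t * c)"
    by (auto simp: dvd_def mult.assoc)
  then obtain N where cofactor: "m ^ t * c = Suc N" by (cases "m ^ t * c") auto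
  then have n_eq: "n = m * N + (m - 1)" using Suc_n base_ge_2 by simp
  have "m - 1 \<le> k" "mary_count m (k - (m - 1)) (m * N) \<noteq> 0"
    using Suc.prems(2) mary_count_mult_add[of "m - 1" k N] base_ge_2
    unfolding n_eq by (auto split: if_splits)
  then obtain l where "l \<le> k - (m - 1)" "mary_count m l N \<noteq> 0"
    using mary_count_mult_nonzero by blast
  moreover from this have "t * (m - 1) \<le> l" using Suc.IH[of N l] by (simp flip: cofactor)
  ultimately show ?case using \<open>m - 1 \<le> k\<close> by simp
qed simp

lemma sum_mary_count_le:
  assumes "M > 0" and bound: "\<And>n. mary_count m k n \<le> b"
  shows "(\<Sum>t<s. mary_count m k (m * (m ^ t * M - 1))) \<le> Suc (k div (m - 1)) * b"
proof -
  let ?f = "\<lambda>t. mary_count m k (m * (m ^ t * M - 1))"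
  have support: "t \<le> k div (m - 1)" if nonzero: "?f t \<noteq> 0" for t
  proof -
    obtain l where "l \<le> k" "mary_count m l (m ^ t * M - 1) \<noteq> 0"
      using mary_count_mult_nonzero[OF nonzero] by blast
    moreover have "m ^ t dvd Suc (m ^ t * M - 1)" using assms(1) base_ge_2 by simp
    ultimately have "t * (m - 1) \<le> k"
      using parts_ge_if_power_dvd_Suc[of t "m ^ t * M - 1" l] by linarith
    with base_ge_2 show ?thesis by (simp add: less_eq_div_iff_mult_less_eq)
  qed
  have "(\<Sum>t<s. ?f t) = (\<Sum>t\<in>{..<s} \<inter> {..k div (m - 1)}. ?f t)"
    using support by (intro sum.mono_neutral_right) auto
  also have "\<dots> \<le> (\<Sum>t\<le>k div (m - 1). ?f t)" by (intro sum_mono2) auto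
  also have "\<dots> \<le> Suc (k div (m - 1)) * b"
    using sum_bounded_above[of "{..k div (m - 1)}" ?f b] bound by simp
  finally show ?thesis .
qed

end

function mary_majorant :: "nat \<Rightarrow> nat \<Rightarrow> nat" where
  "mary_majorant m k = (if m = 0 \<or> k < m then 1
     else mary_majorant m (k - 1) + Suc ((k - m) div (m - 1)) * mary_majorant m (k - m))"
  by auto
termination by (relation "measure snd") auto

declare mary_majorant.simps [simp del]

lemma mary_majorant_less: "k < m \<Longrightarrow> mary_majorant m k = 1"
  by (simp add: mary_majorant.simps)

lemma mary_majorant_add_base:
  "m > 0 \<Longrightarrow> mary_majorant m (k + m) =
     mary_majorant m (k + m - 1) + Suc (k div (m - 1)) * mary_majorant m k"
  by (subst mary_majorant.simps) simp

lemma mono_mary_majorant: "mono (mary_majorant m)"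
proof (rule incseq_SucI)
  show "mary_majorant m k \<le> mary_majorant m (Suc k)" for k
    by (subst (2) mary_majorant.simps) (auto simp: mary_majorant.simps[of m k])
qed

lemma mary_majorant_pos: "0 < mary_majorant m k"
  by (induction m k rule: mary_majorant.induct) (subst mary_majorant.simps, simp)

lemma mary_majorant_Suc_le:
  assumes "Suc k \<le> l + m"
  shows "(m - 1) * mary_majorant m (Suc k) \<le>
    (m - 1) * mary_majorant m k + k * mary_majorant m l"
proof (cases "m = 0 \<or> Suc k < m")
  case True
  then show ?thesis by (auto simp: mary_majorant_less)
next
  case False
  define x where "x = Suc k - m"
  have k_eq: "Suc k = x + m" "k = x + m - 1" and "m > 0" "x \<le> l"
    using False assms by (auto simp: x_def)
  have "(m - 1) * Suc (x div (m - 1)) \<le> k"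
    using k_eq times_div_less_eq_dividend[of "m - 1" x] unfolding mult_Suc_right by linarith
  then have "(m - 1) * Suc (x div (m - 1)) * mary_majorant m x \<le> k * mary_majorant m l"
    using \<open>x \<le> l\<close> by (intro mult_mono monoD[OF mono_mary_majorant]) auto
  moreover have "mary_majorant m (Suc k) =
      mary_majorant m k + Suc (x div (m - 1)) * mary_majorant m x"
    using mary_majorant_add_base[of m x] k_eq \<open>m > 0\<close> by simp
  ultimately show ?thesis by (simp only: add_mult_distrib2 mult.assoc add_le_cancel_left)
qed

lemma mary_majorant_add_le:
  assumes "j \<le> m"
  shows "(m - 1) * mary_majorant m (k + j) \<le> (m - 1 + j * (k + m - 1)) * mary_majorant m k"
  using assms
proof (induction j)
  case (Suc j)
  have "(m - 1) * mary_majorant m (k + Suc j) \<le>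
      (m - 1) * mary_majorant m (k + j) + (k + j) * mary_majorant m k"
    using mary_majorant_Suc_le[of "k + j" k m] Suc.prems by simp
  also have "\<dots> \<le> (m - 1 + j * (k + m - 1)) * mary_majorant m k +
      (k + m - 1) * mary_majorant m k"
    using Suc by (intro add_mono mult_right_mono) auto
  also have "\<dots> = (m - 1 + Suc j * (k + m - 1)) * mary_majorant m k"
    by (simp add: add_mult_distrib)
  finally show ?case .
qed simp

lemma mary_majorant_add_base_le:
  "(m - 1) * mary_majorant m (k + m) \<le> m * (k + m) * mary_majorant m k"
proof -
  have "(m - 1) * mary_majorant m (k + m) \<le> (m - 1 + m * (k + m - 1)) * mary_majorant m k"
    by (rule mary_majorant_add_le) simp
  also have "m - 1 + m * (k + m - 1) \<le> m * (k + m)" by (cases m) auto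
  finally show ?thesis by simp
qed

lemma mary_count_le_majorant_if_not_dvd:
  assumes "m \<ge> 2" "\<not> m dvd n"
    and smaller: "\<And>l n. l < k \<Longrightarrow> mary_count m l n \<le> mary_majorant m l"
  shows "mary_count m k n \<le> mary_majorant m (k - 1)"
proof -
  have "0 < n mod m" using assms(2) by (simp add: dvd_eq_mod_eq_0)
  show ?thesis
  proof (cases "n mod m \<le> k")
    case True
    then have "mary_count m k n \<le> mary_majorant m (k - n mod m)"
      using smaller \<open>0 < n mod m\<close> by (simp add: mary_count_mod[OF assms(1), of k n])
    also have "\<dots> \<le> mary_majorant m (k - 1)"
      using \<open>0 < n mod m\<close> by (intro monoD[OF mono_mary_majorant]) auto
    finally show ?thesis .
  qed (simp add: mary_count_mod[OF assms(1), of k n])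
qed

lemma mary_count_le_majorant:
  assumes "m \<ge> 2"
  shows "mary_count m k n \<le> mary_majorant m k"
proof (induction k arbitrary: n rule: less_induct)
  case (less k)
  show ?case
  proof (cases "n = 0")
    case True
    with mary_majorant_pos[of m k] show ?thesis
      by (auto simp: mary_count_0_right[OF assms] Suc_le_eq)
  next
    case False
    then obtain s M where n_eq: "n = m ^ s * M" and "\<not> m dvd M"
      using multiplicity_decompose'[of n m thesis] assms by auto
    then have "M > 0" by (intro Nat.gr0I) auto
    note count = mary_count_power_mult[OF assms \<open>M > 0\<close>, of k s, folded n_eq]
    have not_dvd: "mary_count m k M \<le> mary_majorant m (k - 1)"
      using mary_count_le_majorant_if_not_dvd[OF assms \<open>\<not> m dvd M\<close>] less.IH by blast
    show ?thesis
    proof (cases "m \<le> k")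
      case True
      then have "(\<Sum>t<s. mary_count m (k - m) (m * (m ^ t * M - 1))) \<le>
          Suc ((k - m) div (m - 1)) * mary_majorant m (k - m)"
        using assms by (intro sum_mary_count_le \<open>M > 0\<close> less.IH) auto
      with not_dvd True show ?thesis
        using count mary_majorant_add_base[of m "k - m"] assms by simp
    next
      case False
      with not_dvd count show ?thesis by (simp add: mary_majorant_less)
    qed
  qed
qed

definition mary_bound :: "nat \<Rightarrow> nat \<Rightarrow> real" where
  "mary_bound m k =
     (real m / (real m - 1)) ^ (k div m) * (\<Prod>j<k div m. real k - real j * real m)"

lemma mary_bound_less: "k < m \<Longrightarrow> mary_bound m k = 1"
  by (simp add: mary_bound_def)

lemma mary_bound_add_base:
  assumes "m > 0"
  shows "mary_bound m (k + m) = real m / (real m - 1) * real (k + m) * mary_bound m k"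
proof -
  have "(\<Prod>j<Suc (k div m). real (k + m) - real j * real m) =
      real (k + m) * (\<Prod>j<k div m. real k - real j * real m)"
    unfolding prod.lessThan_Suc_shift by (simp add: algebra_simps)
  then show ?thesis using assms by (simp add: mary_bound_def)
qed

lemma mary_majorant_le_bound:
  assumes "m \<ge> 2"
  shows "real (mary_majorant m k) \<le> mary_bound m k"
proof (induction k rule: less_induct)
  case (less k)
  show ?case
  proof (cases "k < m")
    case True
    then show ?thesis by (simp add: mary_majorant_less mary_bound_less)
  next
    case False
    then obtain l where k_eq: "k = l + m" by (metis add.commute le_Suc_ex not_less)
    have "real ((m - 1) * mary_majorant m k) \<le> real (m * k * mary_majorant m l)"
      using mary_majorant_add_base_le[of m l] by (simp only: k_eq of_nat_le_iff)
    then have "real (mary_majorant m k) \<le>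
        real m / (real m - 1) * real k * real (mary_majorant m l)"
      using assms by (simp add: field_simps of_nat_diff)
    also have "\<dots> \<le> real m / (real m - 1) * real k * mary_bound m l"
      using less.IH[of l] assms by (intro mult_left_mono) (auto simp: k_eq)
    finally show ?thesis using assms by (simp add: k_eq mary_bound_add_base)
  qed
qed

lemma mary_count_le_bound:
  assumes "m \<ge> 2" "n mod m \<le> k"
  shows "real (mary_count m k n) \<le> mary_bound m (k - n mod m)"
proof -
  have "mary_count m k n = mary_count m (k - n mod m) (m * (n div m))"
    using mary_count_mod[OF assms(1), of k n] assms(2) by simp
  also have "\<dots> \<le> mary_majorant m (k - n mod m)"
    by (rule mary_count_le_majorant[OF assms(1)])
  finally have "real (mary_count m k n) \<le> real (mary_majorant m (k - n mod m))" by simp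
  also have "\<dots> \<le> mary_bound m (k - n mod m)" by (rule mary_majorant_le_bound[OF assms(1)])
  finally show ?thesis .
qed

lemma mary_bound_diff_eq_floor:
  assumes "i \<le> k"
  shows "mary_bound m (k - i) = (real m / (real m - 1)) powi \<lfloor>(real k - real i) / real m\<rfloor> *
    (\<Prod>j = 0..\<lfloor>(real k - real i) / real m\<rfloor> - 1. real k - real i - real_of_int j * real m)"
proof -
  have diff: "real k - real i = real (k - i)" using assms by simp
  have interval: "{0..int q - 1} = {int 0..<int q}" for q by auto
  show ?thesis
    unfolding diff floor_divide_of_nat_eq interval prod.atLeast_int_lessThan_int_shift
    by (simp add: mary_bound_def lessThan_atLeast0)
qed

theorem theorem6p3:
  fixes m k :: nat
  assumes "m \<ge> 2"
  shows "(\<forall>n i :: nat. i < m \<longrightarrow> [n = i] (mod m) \<longrightarrow>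
            real (mary_count m k n) \<le>
              (real m / (real m - 1)) powi \<lfloor>(real k - real i) / real m\<rfloor> *
              (\<Prod>j = 0..\<lfloor>(real k - real i) / real m\<rfloor> - 1.
                 (real k - real i - real_of_int j * real m)))
         \<and> Bseq (\<lambda>n. real (mary_count m k n))"
proof (intro conjI allI impI)
  fix n i :: nat
  assume "i < m" and "[n = i] (mod m)"
  then have residue: "n mod m = i" by (simp add: cong_def)
  let ?q = "\<lfloor>(real k - real i) / real m\<rfloor>"
  show "real (mary_count m k n) \<le> (real m / (real m - 1)) powi ?q *
      (\<Prod>j = 0..?q - 1. (real k - real i - real_of_int j * real m))"
  proof (cases "i \<le> k")
    case True
    then show ?thesis
      using mary_count_le_bound[OF assms, of n k] by (simp add: residue mary_bound_diff_eq_floor)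
  next
    case False
    then have "?q < 0" using assms by (simp add: floor_less_iff divide_neg_pos)
    with False assms show ?thesis
      by (simp add: mary_count_mod[OF assms, of k n] residue zero_le_power_int)
  qed
next
  show "Bseq (\<lambda>n. real (mary_count m k n))"
    using mary_count_le_majorant[OF assms, of k]
    by (intro BseqI'[of _ "real (mary_majorant m k)"]) simp
qed

end
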